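(* For every integer $n\ge 0$, let $I_n$ be the number of ones in row $m=2^n$ of the Pascal rhombus (mod 2), i.e. the number of integers $k$ with $R[2^n,k]$ odd. Then $$I_n=\frac13\left(2^{n+2}-(-1)^n\right).$$
   Context: The Pascal rhombus is the array of integers $R[n,k]$ ($n\ge 0$ an integer row index, $k\in\mathbb{Z}$ a column index) defined by $R[0,j]=0$ for all $j$, $R[1,0]=1$, $R[1,j]=0$ for $j\neq 0$, and $R[n,k]=R[n-1,k-1]+R[n-1,k]+R[n-1,k+1]+R[n-2,k]$ for $n\ge 2$ and all $k$. The non-zero entries are those with $-n<k<n$. The Pascal rhombus (mod 2) is the array of the entries $R[n,k]$ reduced modulo 2. *)

theory Defs
  imports Complex_Main
begin

fun pascal_rhombus :: "nat \<Rightarrow> int \<Rightarrow> int" where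
  "pascal_rhombus 0 k = 0"
| "pascal_rhombus (Suc 0) k = (if k = 0 then 1 else 0)"
| "pascal_rhombus (Suc (Suc n)) k =
     pascal_rhombus (Suc n) (k - 1) + pascal_rhombus (Suc n) k
       + pascal_rhombus (Suc n) (k + 1) + pascal_rhombus n k"

definition rhombus_row_ones :: "nat \<Rightarrow> nat" where
  "rhombus_row_ones m = card {k :: int. odd (pascal_rhombus m k)}"

end

(* Modulo 2 the row polynomials are Fibonacci polynomials, for which F_{2m}(y) = y F_m(y)^2 with
   y = x + 1 + 1/x; squaring substitutes x^2 for x.  So doubling the row index copies row m to the
   even columns and puts the sums of adjacent entries into the odd columns.  If I and D are the
   numbers of ones and of unequal adjacent pairs in row m, then row 2m has I + D ones and 2 I unequal
   adjacent pairs, which gives the recurrence I_{n+2} = I_{n+1} + 2 I_n. *)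
theory Submission
  imports Defs
begin

lemma pascal_rhombus_eq_0: "pascal_rhombus n k = 0" if "int n \<le> \<bar>k\<bar>"
  using that by (induction n k rule: pascal_rhombus.induct) auto

(* The two odd-row identities express F_{2m+1} = F_{m+1}^2 + F_m^2 mod 2. *)
lemma odd_pascal_rhombus_double:
  shows "odd (pascal_rhombus (2 * m) (2 * j)) \<longleftrightarrow> odd (pascal_rhombus m j)"
    and "odd (pascal_rhombus (2 * m) (2 * j + 1)) \<longleftrightarrow>
           odd (pascal_rhombus m j) \<noteq> odd (pascal_rhombus m (j + 1))"
    and "odd (pascal_rhombus (2 * m + 1) (2 * j)) \<longleftrightarrow>
           odd (pascal_rhombus (Suc m) j) \<noteq> odd (pascal_rhombus m j)"
    and "even (pascal_rhombus (2 * m + 1) (2 * j + 1))"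
proof (induction m arbitrary: j)
  case 0
  {
    case 1
    show ?case by simp
  next
    case 2
    show ?case by simp
  next
    case 3
    show ?case by simp
  next
    case 4
    show ?case by simp presburger
  }
next
  case (Suc m)
  let ?R = pascal_rhombus
  \<comment> \<open>The induction hypotheses match only columns written \<open>2 * i\<close> or
    \<open>2 * i + 1\<close>, so the left neighbour of \<open>2 * j\<close> is put into that shape
    with \<open>i = j - 1\<close>.\<close>
  have shift: "2 * (j - 1) + 1 = 2 * j - 1" for j :: int
    by simp
  \<comment> \<open>Both even-row identities are established for all columns first, since the
    recurrence for row \<open>2 * Suc m + 1\<close> needs them at neighbouring columns.\<close>
  have even_even: "odd (?R (2 * Suc m) (2 * j)) \<longleftrightarrow> odd (?R (Suc m) j)" for j
  proof -
    have eq: "?R (2 * Suc m) (2 * j) = ?R (2 * m + 1) (2 * (j - 1) + 1) + ?R (2 * m + 1) (2 * j)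
            + ?R (2 * m + 1) (2 * j + 1) + ?R (2 * m) (2 * j)"
      unfolding shift by simp
    show ?thesis
      \<comment> \<open>Mod 2 the two odd columns vanish, and the term \<open>?R m j\<close> occurs
        twice and cancels.\<close>
      using Suc.IH(1)[of j] Suc.IH(3)[of j] Suc.IH(4)[of j] Suc.IH(4)[of "j - 1"]
      unfolding eq even_add by argo
  qed
  have even_odd: "odd (?R (2 * Suc m) (2 * j + 1)) \<longleftrightarrow>
      odd (?R (Suc m) j) \<noteq> odd (?R (Suc m) (j + 1))" for j
  proof -
    have eq: "?R (2 * Suc m) (2 * j + 1) = ?R (2 * m + 1) (2 * j) + ?R (2 * m + 1) (2 * j + 1)
            + ?R (2 * m + 1) (2 * (j + 1)) + ?R (2 * m) (2 * j + 1)"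
      by (simp add: add.assoc)
    show ?thesis
      using Suc.IH(2)[of j] Suc.IH(3)[of j] Suc.IH(3)[of "j + 1"] Suc.IH(4)[of j]
      unfolding eq even_add by argo
  qed
  {
    case 1
    show ?case by (rule even_even)
  next
    case 2
    show ?case by (rule even_odd)
  next
    case 3
    have eq: "?R (2 * Suc m + 1) (2 * j) = ?R (2 * Suc m) (2 * (j - 1) + 1) + ?R (2 * Suc m) (2 * j)
            + ?R (2 * Suc m) (2 * j + 1) + ?R (2 * m + 1) (2 * j)"
      unfolding shift by simp
    \<comment> \<open>The right-hand side is expanded too: mod 2 both sides become the sum of
      \<open>?R (Suc m) (j - 1)\<close>, \<open>?R (Suc m) (j + 1)\<close> and
      \<open>?R m j\<close>.\<close>
    have eq': "?R (Suc (Suc m)) j = ?R (Suc m) (j - 1) + ?R (Suc m) j + ?R (Suc m) (j + 1) + ?R m j"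
      by simp
    show ?case
      using even_even[of j] even_odd[of j] even_odd[of "j - 1"] Suc.IH(3)[of j]
      unfolding eq eq' even_add diff_add_cancel by argo
  next
    case 4
    have eq: "?R (2 * Suc m + 1) (2 * j + 1) = ?R (2 * Suc m) (2 * j) + ?R (2 * Suc m) (2 * j + 1)
            + ?R (2 * Suc m) (2 * (j + 1)) + ?R (2 * m + 1) (2 * j + 1)"
      by (simp add: add.assoc)
    show ?case
      using even_even[of j] even_even[of "j + 1"] even_odd[of j] Suc.IH(4)[of j]
      unfolding eq even_add by blast
  }
qed

definition rhombus_row_changes :: "nat \<Rightarrow> nat" where
  "rhombus_row_changes m =
     card {k :: int. odd (pascal_rhombus m k) \<noteq> odd (pascal_rhombus m (k + 1))}"

text \<open>As \<open>card\<close> is 0 on infinite sets, finiteness is what allows the counts over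
  even and odd columns to be added.\<close>

lemma finite_rhombus_row_ones: "finite {k. odd (pascal_rhombus m k)}"
proof (rule finite_subset)
  show "{k. odd (pascal_rhombus m k)} \<subseteq> {- int m..int m}"
  proof clarify
    fix k assume "odd (pascal_rhombus m k)"
    then have "pascal_rhombus m k \<noteq> 0"
      by auto
    then have "\<bar>k\<bar> < int m"
      by (meson not_less pascal_rhombus_eq_0)
    then show "k \<in> {- int m..int m}"
      by auto
  qed
qed simp

lemma finite_rhombus_row_changes:
  "finite {k. odd (pascal_rhombus m k) \<noteq> odd (pascal_rhombus m (k + 1))}"
proof (rule finite_subset)
  show "{k. odd (pascal_rhombus m k) \<noteq> odd (pascal_rhombus m (k + 1))} \<subseteq> {- int m - 1..int m}"
  proof clarify
    fix k assume "odd (pascal_rhombus m k) \<noteq> odd (pascal_rhombus m (k + 1))"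
    then have "pascal_rhombus m k \<noteq> 0 \<or> pascal_rhombus m (k + 1) \<noteq> 0"
      by auto
    then have "\<bar>k\<bar> < int m \<or> \<bar>k + 1\<bar> < int m"
      by (meson not_less pascal_rhombus_eq_0)
    then show "k \<in> {- int m - 1..int m}"
      by auto
  qed
qed simp

lemma card_split_parity:
  fixes P :: "int \<Rightarrow> bool"
  assumes "finite {j. P (2 * j)}" "finite {j. P (2 * j + 1)}"
  shows "card {k. P k} = card {j. P (2 * j)} + card {j. P (2 * j + 1)}"
proof -
  let ?A = "(\<lambda>j. 2 * j) ` {j. P (2 * j)}" and ?B = "(\<lambda>j. 2 * j + 1) ` {j. P (2 * j + 1)}"
  have "{k. P k} = ?A \<union> ?B"
    by (auto elim!: evenE oddE simp: image_iff) (metis evenE oddE)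
  moreover have "?A \<inter> ?B = {}"
    by auto presburger
  moreover have "card ?A = card {j. P (2 * j)}" "card ?B = card {j. P (2 * j + 1)}"
    by (auto intro!: card_image inj_onI)
  ultimately show ?thesis
    using assms by (simp add: card_Un_disjoint)
qed

lemma rhombus_row_ones_double:
  "rhombus_row_ones (2 * m) = rhombus_row_ones m + rhombus_row_changes m"
  unfolding rhombus_row_ones_def rhombus_row_changes_def
  using card_split_parity[of "\<lambda>k. odd (pascal_rhombus (2 * m) k)"]
    finite_rhombus_row_ones[of m] finite_rhombus_row_changes[of m]
  by (simp only: odd_pascal_rhombus_double)

lemma rhombus_row_changes_double: "rhombus_row_changes (2 * m) = 2 * rhombus_row_ones m"
proof -
  let ?a = "\<lambda>k. odd (pascal_rhombus m k)"
  let ?P = "\<lambda>k. odd (pascal_rhombus (2 * m) k) \<noteq> odd (pascal_rhombus (2 * m) (k + 1))"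
  \<comment> \<open>Columns \<open>2 * j\<close>, \<open>2 * j + 1\<close>, \<open>2 * j + 2\<close>
    of the doubled row carry a(j), a(j) + a(j+1), a(j+1) mod 2, so consecutive entries differ by
    a(j+1) and by a(j).\<close>
  have even_col: "?P (2 * j) \<longleftrightarrow> ?a (j + 1)" for j
    by (auto simp only: odd_pascal_rhombus_double)
  have "2 * j + 1 + 1 = 2 * (j + 1)" for j :: int
    by simp
  then have odd_col: "?P (2 * j + 1) \<longleftrightarrow> ?a j" for j
    by (auto simp only: odd_pascal_rhombus_double)
  \<comment> \<open>Translation by one column shows that both parity classes contribute the same
    number of changes.\<close>
  have shift: "{j. ?a j} = (\<lambda>j. j + 1) ` {j. ?a (j + 1)}"
    by (auto simp: image_iff) (metis diff_add_cancel)
  have fin: "finite {j. ?a (j + 1)}"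
    using finite_rhombus_row_ones[of m] unfolding shift by (rule finite_imageD) simp
  have "card {j. ?a (j + 1)} = card {j. ?a j}"
    unfolding shift by (simp add: card_image)
  then show ?thesis
    unfolding rhombus_row_ones_def rhombus_row_changes_def
    using card_split_parity[of ?P] fin finite_rhombus_row_ones[of m]
    by (simp only: even_col odd_col)
qed

text \<open>Doubling acts linearly by (I, D) -> (I + D, 2 I), with eigenvectors (1, 1) for 2 and (1,
  -2) for -1. The start (1, 2) is 4/3 (1, 1) - 1/3 (1, -2), which yields both closed forms; the
  factor 3 keeps them in the integers.\<close>

lemma rhombus_row_power2:
  "3 * int (rhombus_row_ones (2 ^ n)) = 2 ^ (n + 2) - (- 1) ^ n \<and>
   3 * int (rhombus_row_changes (2 ^ n)) = 2 ^ (n + 2) + 2 * (- 1) ^ n"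
proof (induction n)
  case 0
  \<comment> \<open>The single one of row 1 differs from each of its two neighbours, so I = 1 and D
    = 2.\<close>
  have "{k :: int. odd (pascal_rhombus 1 k)} = {0}"
    by auto
  moreover have "{k :: int. odd (pascal_rhombus 1 k) \<noteq> odd (pascal_rhombus 1 (k + 1))} = {0, - 1}"
    by auto
  ultimately show ?case
    by (simp add: rhombus_row_ones_def rhombus_row_changes_def)
next
  case (Suc n)
  then show ?case
    by (simp add: rhombus_row_ones_double rhombus_row_changes_double)
qed

theorem mainTheorem2:
  fixes n :: nat
  shows "real (rhombus_row_ones (2 ^ n)) = 1 / 3 * (2 ^ (n + 2) - (- 1) ^ n)"
proof -
  have "real_of_int (3 * int (rhombus_row_ones (2 ^ n))) = real_of_int (2 ^ (n + 2) - (- 1) ^ n)"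
    using rhombus_row_power2[of n] by presburger
  then show ?thesis
    by simp
qed

end
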